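(* Let $N$ and $k$ be integers with $1<k<N$. Let $c_n(t),\lambda_n(t)$ satisfy the perturbed extended relativistic Toda equations (listed in the context) with $c_0(t)=1$, $\lambda_0=-1$, $\lambda_1=0$ and the further restriction $\lambda_{N+1}=0$, and put $\gamma_n(t)=\lambda_{n+1}(t)+c_n(t)$. Then the perturbed extended relativistic Toda equations satisfy the matrix differential equation $$\dot{\mathcal{E}}_n=\mathcal{E}_n\mathcal{X}_n-\mathcal{Y}_n\mathcal{E}_n,$$ where $$\mathcal{X}_n=p\,\mathcal{L}'_n\mathcal{F}_n+q\,\mathcal{L}'_n\mathcal{G}_n+\tfrac12\mathcal{E}_n^{-1}[p\mathcal{H}_n+q\mathcal{J}_n],\qquad \mathcal{Y}_n=p\,\mathcal{F}_n\mathcal{L}''_n+q\,\mathcal{G}_n\mathcal{L}''_n-\tfrac12[p\mathcal{H}_n+q\mathcal{J}_n]\mathcal{E}_n^{-1},$$ and $\mathcal{E}_n,\mathcal{L}_n,\mathcal{F}_n,\mathcal{G}_n,\mathcal{H}_n,\mathcal{J}_n$ are the $N\times N$ matrices defined in the context, with $\mathcal{L}'_n,\mathcal{L}''_n$ defined by $\mathcal{L}_n=\mathcal{E}_n\mathcal{L}'_n=\mathcal{L}''_n\mathcal{E}_n$.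
   Context: A dot denotes $d/dt$; $p,q\in\mathbb{C}$ with $p\ne0$ (since $p^{-1}$ occurs below); $\mu_{k+1}(t),\nu_{k+1}(t)$ are differentiable functions; all denominators are assumed nonzero and $\mathcal{E}_n$ invertible. The variable $t$ is omitted. Perturbed extended relativistic Toda equations (for the finite system, $1\le n\le N$ with $\lambda_{N+1}=0$, terms with factor $\lambda_{N+1}$ being zero). For the $c_n$: $$\frac{\dot c_k}{c_k}=p(\lambda_k-\nu_{k+1}\lambda_{k+1})+q\left(\frac{\nu_{k+1}\lambda_{k+1}}{(c_{k+1}-\mu_{k+1})c_k}-\frac{\lambda_k}{c_kc_{k-1}}\right),$$ $$\dot c_{k+1}=\dot\mu_{k+1}+p(c_{k+1}-\mu_{k+1})(\nu_{k+1}\lambda_{k+1}-\lambda_{k+2})+q\left(\frac{\lambda_{k+2}}{c_{k+2}}-\frac{\nu_{k+1}\lambda_{k+1}}{c_k}\right),$$ $$\frac{\dot c_{k+2}}{c_{k+2}}=p(\lambda_{k+2}-\lambda_{k+3})+q\left(\frac{\lambda_{k+3}}{c_{k+2}c_{k+3}}-\frac{\lambda_{k+2}}{(c_{k+1}-\mu_{k+1})c_{k+2}}\right),$$ $$\frac{\dot c_n}{c_n}=p(\lambda_n-\lambda_{n+1})+q\left(\frac{\lambda_{n+1}}{c_{n+1}c_n}-\frac{\lambda_n}{c_nc_{n-1}}\right),\quad n\notin\{k,k+1,k+2\}.$$ For the $\lambda_n$ ($n\ge2$): $$\frac{\dot\lambda_{k+1}}{\lambda_{k+1}}=-\frac{\dot\nu_{k+1}}{\nu_{k+1}}-p\big(\lambda_{k+2}+c_{k+1}-\mu_{k+1}+(\nu_{k+1}-1)\lambda_{k+1}-c_k-\lambda_k\big)-q\left(\frac{1}{c_{k+1}-\mu_{k+1}}-\frac1{c_k}\right),$$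 $$\frac{\dot\lambda_{k+2}}{\lambda_{k+2}}=-p\big[\lambda_{k+3}+c_{k+2}-(c_{k+1}-\mu_{k+1})-\nu_{k+1}\lambda_{k+1}\big]-q\left(\frac1{c_{k+2}}-\frac1{c_{k+1}-\mu_{k+1}}\right),$$ $$\frac{\dot\lambda_n}{\lambda_n}=p(\lambda_{n-1}+c_{n-1}-\lambda_{n+1}-c_n)+q\left(\frac1{c_{n-1}}-\frac1{c_n}\right),\quad n\notin\{k+1,k+2\}.$$ Matrices (all $N\times N$; rows and columns indexed $1,\dots,N$; any entry with an index exceeding $N$ is dropped; unlisted entries are $0$): - $\mathcal{E}_n$: $(\mathcal{E}_n)_{i,j}=\gamma_j$ for $j\ge i$; $(\mathcal{E}_n)_{i,i-1}=\lambda_i$ for $2\le i\le N$. - $\mathcal{L}_n$: equal to $\mathcal{E}_n$ except $(\mathcal{L}_n)_{k+1,k}=\nu_{k+1}\lambda_{k+1}$ and $(\mathcal{L}_n)_{k+1,k+1}=\gamma_{k+1}-\mu_{k+1}$. Thus $\mathcal{L}'_n=\mathcal{E}_n^{-1}\mathcal{L}_n$ and $\mathcal{L}''_n=\mathcal{L}_n\mathcal{E}_n^{-1}$. - $\mathcal{F}_n$: $(\mathcal{F}_n)_{i,i}=\lambda_i$ for $1\le i\le N$; $(\mathcal{F}_n)_{i,i-1}=-\lambda_i$ for $2\le i\le N$. - $\mathcal{G}_n$: $(\mathcal{G}_n)_{i,i}=\frac{1}{\gamma_i-\lambda_{i+1}}$ for $i\ne k+1$, $(\mathcal{G}_n)_{k+1,k+1}=\frac{1}{\gamma_{k+1}-\lambda_{k+2}-\mu_{k+1}}$,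 and $(\mathcal{G}_n)_{i,i+1}=-(\mathcal{G}_n)_{i,i}$ for $1\le i\le N-1$. - $\mathcal{H}_n$: $(\mathcal{H}_n)_{i,k}=h_1$ for $1\le i\le k$; $(\mathcal{H}_n)_{i,k+1}=h_2$ for $1\le i\le k+1$; $(\mathcal{H}_n)_{k+1,k-1}=h_4$; $(\mathcal{H}_n)_{k+1,k}=h_3$; $(\mathcal{H}_n)_{k+2,k}=(\mathcal{H}_n)_{k+2,k+1}=h_5$, where $$h_1=\left[-\frac{\dot\nu_{k+1}}{p\,\nu_{k+1}}+(1-\nu_{k+1})\gamma_k+\mu_{k+1}\right]\lambda_{k+1},\qquad h_2=\lambda_{k+1}[\nu_{k+1}(\gamma_{k+1}-\mu_{k+1})-\gamma_{k+1}]+p^{-1}\dot\mu_{k+1},$$ $$h_3=-\frac{\dot\nu_{k+1}\lambda_{k+1}}{p\,\nu_{k+1}}+(1-\nu_{k+1})\lambda_k\lambda_{k+1},\qquad h_4=-(1-\nu_{k+1})\lambda_k\lambda_{k+1},\qquad h_5=-(1-\nu_{k+1})\lambda_{k+1}\lambda_{k+2}.$$ - $\mathcal{J}_n$: for $1\le i\le k-1$, $(\mathcal{J}_n)_{i,k}=j_1$, $(\mathcal{J}_n)_{i,k+1}=j_2$, $(\mathcal{J}_n)_{i,k+2}=j_3$; in row $k$, $(\mathcal{J}_n)_{k,k}=j_4$, $(\mathcal{J}_n)_{k,k+1}=j_5$, $(\mathcal{J}_n)_{k,k+2}=j_3$; in row $k+1$, $(\mathcal{J}_n)_{k+1,k}=j_4$,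 where $$j_1=\frac{(\nu_{k+1}-1)\lambda_{k+1}}{\gamma_{k+1}-\lambda_{k+2}-\mu_{k+1}},\qquad j_2=1+\frac{(1-\nu_{k+1})\lambda_{k+1}}{\gamma_k-\lambda_{k+1}}+\frac{\lambda_{k+2}-\gamma_{k+1}}{\gamma_{k+1}-\lambda_{k+2}-\mu_{k+1}},$$ $$j_3=-1+\frac{\lambda_{k+2}-\gamma_{k+1}}{\gamma_{k+1}-\lambda_{k+2}-\mu_{k+1}},\qquad j_4=(1-\nu_{k+1})\left(\frac{\lambda_{k+1}}{\gamma_k-\lambda_{k+1}}-\frac{\lambda_{k+1}}{\gamma_{k+1}-\lambda_{k+2}-\mu_{k+1}}\right),$$ $$j_5=\frac{(\gamma_k-\mu_{k+1}-\nu_{k+1})\lambda_{k+1}}{\gamma_k-\lambda_{k+1}}+\frac{\lambda_{k+2}-\gamma_{k+1}}{\gamma_{k+1}-\lambda_{k+2}-\mu_{k+1}}.$$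
   Formalization: As printed, H and J make the identity false; here (H)_{k+2,k} = -h_5, j_3 = -1-(λ_{k+2}-γ_{k+1})/(γ_{k+1}-λ_{k+2}-μ_{k+1}), and the first numerator of j_5 is γ_k+μ_{k+1}-ν_{k+1}λ_{k+1}; all else is as stated. *)

theory Defs
  imports
    "HOL-Analysis.Analysis"
    "Jordan_Normal_Form.Matrix"
    "Jordan_Normal_Form.Gauss_Jordan_Elimination"
begin

text \<open>Sequences of functions are given as \<open>c n t\<close>, \<open>lam n t\<close> with a real time \<open>t\<close> and complex values;
  \<open>\<mu>\<close> and \<open>\<nu>\<close> stand for the only perturbation functions \<open>\<mu>\<^sub>k\<^sub>+\<^sub>1\<close> and \<open>\<nu>\<^sub>k\<^sub>+\<^sub>1\<close>.\<close>

type_synonym sequence = "nat \<Rightarrow> real \<Rightarrow> complex"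

abbreviation ddt :: "(real \<Rightarrow> complex) \<Rightarrow> real \<Rightarrow> complex" where
  "ddt f t \<equiv> vector_derivative f (at t)"

section \<open>The perturbed extended relativistic Toda equations\<close>

text \<open>The quotients by \<open>c (N + 1)\<close> and \<open>c (k + 2)\<close> with \<open>k + 2 = N + 1\<close> that formally occur below
  all have numerator \<open>lam (N + 1) t = 0\<close>, hence are \<open>0\<close> whatever the denominator is.\<close>

definition toda_c :: "nat \<Rightarrow> nat \<Rightarrow> complex \<Rightarrow> complex \<Rightarrow> (real \<Rightarrow> complex) \<Rightarrow> (real \<Rightarrow> complex) \<Rightarrow>
    sequence \<Rightarrow> sequence \<Rightarrow> real \<Rightarrow> bool" where
  "toda_c N k p q \<mu> \<nu> c lam t \<longleftrightarrow>
     ddt (c k) t / c k t =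
       p * (lam k t - \<nu> t * lam (k+1) t)
       + q * (\<nu> t * lam (k+1) t / ((c (k+1) t - \<mu> t) * c k t) - lam k t / (c k t * c (k-1) t)) \<and>
     ddt (c (k+1)) t =
       ddt \<mu> t + p * (c (k+1) t - \<mu> t) * (\<nu> t * lam (k+1) t - lam (k+2) t)
       + q * (lam (k+2) t / c (k+2) t - \<nu> t * lam (k+1) t / c k t) \<and>
     (k + 2 \<le> N \<longrightarrow>
       ddt (c (k+2)) t / c (k+2) t =
         p * (lam (k+2) t - lam (k+3) t)
         + q * (lam (k+3) t / (c (k+2) t * c (k+3) t)
                - lam (k+2) t / ((c (k+1) t - \<mu> t) * c (k+2) t))) \<and>
     (\<forall>n \<in> {1..N} - {k, k+1, k+2}.
       ddt (c n) t / c n t =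
         p * (lam n t - lam (n+1) t)
         + q * (lam (n+1) t / (c (n+1) t * c n t) - lam n t / (c n t * c (n-1) t)))"

definition toda_lambda :: "nat \<Rightarrow> nat \<Rightarrow> complex \<Rightarrow> complex \<Rightarrow> (real \<Rightarrow> complex) \<Rightarrow> (real \<Rightarrow> complex) \<Rightarrow>
    sequence \<Rightarrow> sequence \<Rightarrow> real \<Rightarrow> bool" where
  "toda_lambda N k p q \<mu> \<nu> c lam t \<longleftrightarrow>
     ddt (lam (k+1)) t / lam (k+1) t =
       - (ddt \<nu> t / \<nu> t)
       - p * (lam (k+2) t + c (k+1) t - \<mu> t + (\<nu> t - 1) * lam (k+1) t - c k t - lam k t)
       - q * (1 / (c (k+1) t - \<mu> t) - 1 / c k t) \<and>
     (k + 2 \<le> N \<longrightarrow>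
       ddt (lam (k+2)) t / lam (k+2) t =
         - p * (lam (k+3) t + c (k+2) t - (c (k+1) t - \<mu> t) - \<nu> t * lam (k+1) t)
         - q * (1 / c (k+2) t - 1 / (c (k+1) t - \<mu> t))) \<and>
     (\<forall>n \<in> {2..N} - {k+1, k+2}.
       ddt (lam n) t / lam n t =
         p * (lam (n-1) t + c (n-1) t - lam (n+1) t - c n t)
         + q * (1 / c (n-1) t - 1 / c n t))"

definition perturbed_toda :: "nat \<Rightarrow> nat \<Rightarrow> complex \<Rightarrow> complex \<Rightarrow> (real \<Rightarrow> complex) \<Rightarrow> (real \<Rightarrow> complex) \<Rightarrow>
    sequence \<Rightarrow> sequence \<Rightarrow> real set \<Rightarrow> bool" where
  "perturbed_toda N k p q \<mu> \<nu> c lam T \<longleftrightarrow>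
     (\<forall>t\<in>T. \<mu> differentiable (at t) \<and> \<nu> differentiable (at t) \<and>
       (\<forall>n\<in>{1..N}. c n differentiable (at t)) \<and>
       (\<forall>n\<in>{2..N}. lam n differentiable (at t)) \<and>
       toda_c N k p q \<mu> \<nu> c lam t \<and> toda_lambda N k p q \<mu> \<nu> c lam t)"

text \<open>The value \<open>c (k + 1) t\<close> is never a denominator: only \<open>c (k + 1) t - \<mu> t\<close> is.\<close>

definition denominators_nonzero :: "nat \<Rightarrow> nat \<Rightarrow> (real \<Rightarrow> complex) \<Rightarrow> (real \<Rightarrow> complex) \<Rightarrow>
    sequence \<Rightarrow> sequence \<Rightarrow> real set \<Rightarrow> bool" where
  "denominators_nonzero N k \<mu> \<nu> c lam T \<longleftrightarrow>
     (\<forall>t\<in>T. (\<forall>n \<in> {1..N} - {k+1}. c n t \<noteq> 0) \<and> c (k+1) t - \<mu> t \<noteq> 0 \<and>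
       (\<forall>n\<in>{2..N}. lam n t \<noteq> 0) \<and> \<nu> t \<noteq> 0)"

section \<open>The matrices\<close>

definition gam :: "sequence \<Rightarrow> sequence \<Rightarrow> sequence" where
  "gam c lam n t = lam (n+1) t + c n t"

text \<open>Library matrices are indexed from \<open>0\<close>; the entry function \<open>f\<close> below uses indices \<open>1..N\<close>,
  and its values at larger indices are dropped.\<close>

definition mat1 :: "nat \<Rightarrow> (nat \<Rightarrow> nat \<Rightarrow> complex) \<Rightarrow> complex mat" where
  "mat1 N f = mat N N (\<lambda>(i, j). f (i+1) (j+1))"

definition matE :: "nat \<Rightarrow> sequence \<Rightarrow> sequence \<Rightarrow> real \<Rightarrow> complex mat" where
  "matE N c lam t = mat1 N (\<lambda>i j.
     if i \<le> j then gam c lam j t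
     else if i = j + 1 then lam i t
     else 0)"

definition matL :: "nat \<Rightarrow> nat \<Rightarrow> (real \<Rightarrow> complex) \<Rightarrow> (real \<Rightarrow> complex) \<Rightarrow>
    sequence \<Rightarrow> sequence \<Rightarrow> real \<Rightarrow> complex mat" where
  "matL N k \<mu> \<nu> c lam t = mat1 N (\<lambda>i j.
     if i = k+1 \<and> j = k then \<nu> t * lam (k+1) t
     else if i = k+1 \<and> j = k+1 then gam c lam (k+1) t - \<mu> t
     else if i \<le> j then gam c lam j t
     else if i = j + 1 then lam i t
     else 0)"

definition matF :: "nat \<Rightarrow> sequence \<Rightarrow> real \<Rightarrow> complex mat" where
  "matF N lam t = mat1 N (\<lambda>i j.
     if i = j then lam i t
     else if i = j + 1 then - lam i t
     else 0)"

definition matG :: "nat \<Rightarrow> nat \<Rightarrow> (real \<Rightarrow> complex) \<Rightarrow> sequence \<Rightarrow> sequence \<Rightarrow> real \<Rightarrow> complex mat" where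
  "matG N k \<mu> c lam t =
    (let g = (\<lambda>i. if i = k+1 then 1 / (gam c lam (k+1) t - lam (k+2) t - \<mu> t)
                  else 1 / (gam c lam i t - lam (i+1) t))
     in mat1 N (\<lambda>i j.
       if i = j then g i
       else if j = i + 1 then - g i
       else 0))"

text \<open>In \<open>matH\<close> the entry in row \<open>k + 2\<close>, column \<open>k\<close> is \<open>- h5\<close>. The source prints \<open>h5\<close> there, which
  is a misprint: this entry of \<open>E'\<close> is \<open>0\<close>, and the same entry of \<open>L F - F L\<close> is
  \<open>- (1 - \<nu>) \<lambda>\<^sub>k\<^sub>+\<^sub>1 \<lambda>\<^sub>k\<^sub>+\<^sub>2 = h5\<close>, which \<open>H\<close> has to cancel.\<close>

definition matH :: "nat \<Rightarrow> nat \<Rightarrow> complex \<Rightarrow> (real \<Rightarrow> complex) \<Rightarrow> (real \<Rightarrow> complex) \<Rightarrow>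
    sequence \<Rightarrow> sequence \<Rightarrow> real \<Rightarrow> complex mat" where
  "matH N k p \<mu> \<nu> c lam t =
    (let \<gamma> = (\<lambda>n. gam c lam n t);
         h1 = (- (ddt \<nu> t / (p * \<nu> t)) + (1 - \<nu> t) * \<gamma> k + \<mu> t) * lam (k+1) t;
         h2 = lam (k+1) t * (\<nu> t * (\<gamma> (k+1) - \<mu> t) - \<gamma> (k+1)) + inverse p * ddt \<mu> t;
         h3 = - (ddt \<nu> t * lam (k+1) t / (p * \<nu> t)) + (1 - \<nu> t) * lam k t * lam (k+1) t;
         h4 = - ((1 - \<nu> t) * lam k t * lam (k+1) t);
         h5 = - ((1 - \<nu> t) * lam (k+1) t * lam (k+2) t)
     in mat1 N (\<lambda>i j.
       if i \<le> k \<and> j = k then h1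
       else if i \<le> k+1 \<and> j = k+1 then h2
       else if i = k+1 \<and> j = k-1 then h4
       else if i = k+1 \<and> j = k then h3
       else if i = k+2 \<and> j = k then - h5
       else if i = k+2 \<and> j = k+1 then h5
       else 0))"

text \<open>Two entries of \<open>matJ\<close> also correct misprints. Without perturbation (\<open>\<mu> = 0\<close>, \<open>\<nu> = 1\<close>) all
  entries of \<open>J\<close> must vanish, because then \<open>E' = p (E F - F E) + q (E G - G E)\<close>.
  \<^item> \<open>j3\<close>: the source prints \<open>- 1 + (\<lambda>\<^sub>k\<^sub>+\<^sub>2 - \<gamma>\<^sub>k\<^sub>+\<^sub>1) / d\<close>, which is then \<open>- 2\<close>.
  \<^item> \<open>j5\<close>: the source prints \<open>(\<gamma>\<^sub>k - \<mu> - \<nu>) \<lambda>\<^sub>k\<^sub>+\<^sub>1\<close> as the first numerator; the value needed is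
    \<open>\<gamma>\<^sub>k + \<mu> - \<nu> \<lambda>\<^sub>k\<^sub>+\<^sub>1\<close>, i.e. \<open>j5 = j2 + \<mu> / (\<gamma>\<^sub>k - \<lambda>\<^sub>k\<^sub>+\<^sub>1)\<close>.\<close>

definition matJ :: "nat \<Rightarrow> nat \<Rightarrow> (real \<Rightarrow> complex) \<Rightarrow> (real \<Rightarrow> complex) \<Rightarrow>
    sequence \<Rightarrow> sequence \<Rightarrow> real \<Rightarrow> complex mat" where
  "matJ N k \<mu> \<nu> c lam t =
    (let \<gamma> = (\<lambda>n. gam c lam n t);
         d = \<gamma> (k+1) - lam (k+2) t - \<mu> t;
         e = \<gamma> k - lam (k+1) t;
         j1 = (\<nu> t - 1) * lam (k+1) t / d;
         j2 = 1 + (1 - \<nu> t) * lam (k+1) t / e + (lam (k+2) t - \<gamma> (k+1)) / d;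
         j3 = - 1 - (lam (k+2) t - \<gamma> (k+1)) / d;
         j4 = (1 - \<nu> t) * (lam (k+1) t / e - lam (k+1) t / d);
         j5 = (\<gamma> k + \<mu> t - \<nu> t * lam (k+1) t) / e + (lam (k+2) t - \<gamma> (k+1)) / d
     in mat1 N (\<lambda>i j.
       if i \<le> k-1 \<and> j = k then j1
       else if i \<le> k-1 \<and> j = k+1 then j2
       else if i \<le> k-1 \<and> j = k+2 then j3
       else if i = k \<and> j = k then j4
       else if i = k \<and> j = k+1 then j5
       else if i = k \<and> j = k+2 then j3
       else if i = k+1 \<and> j = k then j4
       else 0))"

definition mat_inv :: "complex mat \<Rightarrow> complex mat" where
  "mat_inv A = the (mat_inverse A)"

definition matL' :: "nat \<Rightarrow> nat \<Rightarrow> (real \<Rightarrow> complex) \<Rightarrow> (real \<Rightarrow> complex) \<Rightarrow>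
    sequence \<Rightarrow> sequence \<Rightarrow> real \<Rightarrow> complex mat" where
  "matL' N k \<mu> \<nu> c lam t = mat_inv (matE N c lam t) * matL N k \<mu> \<nu> c lam t"

definition matL'' :: "nat \<Rightarrow> nat \<Rightarrow> (real \<Rightarrow> complex) \<Rightarrow> (real \<Rightarrow> complex) \<Rightarrow>
    sequence \<Rightarrow> sequence \<Rightarrow> real \<Rightarrow> complex mat" where
  "matL'' N k \<mu> \<nu> c lam t = matL N k \<mu> \<nu> c lam t * mat_inv (matE N c lam t)"

definition matX :: "nat \<Rightarrow> nat \<Rightarrow> complex \<Rightarrow> complex \<Rightarrow> (real \<Rightarrow> complex) \<Rightarrow> (real \<Rightarrow> complex) \<Rightarrow>
    sequence \<Rightarrow> sequence \<Rightarrow> real \<Rightarrow> complex mat" where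
  "matX N k p q \<mu> \<nu> c lam t =
     p \<cdot>\<^sub>m (matL' N k \<mu> \<nu> c lam t * matF N lam t)
     + q \<cdot>\<^sub>m (matL' N k \<mu> \<nu> c lam t * matG N k \<mu> c lam t)
     + (1/2) \<cdot>\<^sub>m (mat_inv (matE N c lam t)
         * (p \<cdot>\<^sub>m matH N k p \<mu> \<nu> c lam t + q \<cdot>\<^sub>m matJ N k \<mu> \<nu> c lam t))"

definition matY :: "nat \<Rightarrow> nat \<Rightarrow> complex \<Rightarrow> complex \<Rightarrow> (real \<Rightarrow> complex) \<Rightarrow> (real \<Rightarrow> complex) \<Rightarrow>
    sequence \<Rightarrow> sequence \<Rightarrow> real \<Rightarrow> complex mat" where
  "matY N k p q \<mu> \<nu> c lam t =
     p \<cdot>\<^sub>m (matF N lam t * matL'' N k \<mu> \<nu> c lam t)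
     + q \<cdot>\<^sub>m (matG N k \<mu> c lam t * matL'' N k \<mu> \<nu> c lam t)
     - (1/2) \<cdot>\<^sub>m ((p \<cdot>\<^sub>m matH N k p \<mu> \<nu> c lam t + q \<cdot>\<^sub>m matJ N k \<mu> \<nu> c lam t)
         * mat_inv (matE N c lam t))"

definition has_mat_derivative :: "(real \<Rightarrow> complex mat) \<Rightarrow> complex mat \<Rightarrow> real \<Rightarrow> bool" where
  "has_mat_derivative A D t \<longleftrightarrow>
     (\<forall>s. dim_row (A s) = dim_row D \<and> dim_col (A s) = dim_col D) \<and>
     (\<forall>i<dim_row D. \<forall>j<dim_col D.
        ((\<lambda>s. A s $$ (i, j)) has_vector_derivative D $$ (i, j)) (at t))"

lemma mat_inv_invertible:
  assumes "A \<in> carrier_mat n n" and "invertible_mat A"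
  shows "mat_inv A \<in> carrier_mat n n" "A * mat_inv A = 1\<^sub>m n" "mat_inv A * A = 1\<^sub>m n"
proof -
  obtain B where B: "A * B = 1\<^sub>m n" "B * A = 1\<^sub>m (dim_row B)"
    using assms unfolding invertible_mat_def inverts_mat_def by auto
  have dims: "dim_col B = n" "dim_row B = n"
    using arg_cong[OF B(1), of dim_col] arg_cong[OF B(2), of dim_col] assms(1) by auto
  then have "A \<in> Units (ring_mat TYPE(complex) n ())"
    using B assms(1) unfolding Units_def ring_mat_def by auto
  then obtain C where C: "mat_inverse A = Some C"
    using mat_inverse(1)[OF assms(1), where b = "()"] by (cases "mat_inverse A") auto
  then show "mat_inv A \<in> carrier_mat n n" "A * mat_inv A = 1\<^sub>m n" "mat_inv A * A = 1\<^sub>m n"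
    using mat_inverse(2)[OF assms(1) C] by (auto simp: mat_inv_def)
qed

lemma matE_carrier: "matE N c lam t \<in> carrier_mat N N"
  by (simp add: matE_def mat1_def)

lemma matL_carrier: "matL N k \<mu> \<nu> c lam t \<in> carrier_mat N N"
  by (simp add: matL_def mat1_def)

lemma matL_factorizations:
  assumes "invertible_mat (matE N c lam t)"
  shows "matL N k \<mu> \<nu> c lam t = matE N c lam t * matL' N k \<mu> \<nu> c lam t"
    and "matL N k \<mu> \<nu> c lam t = matL'' N k \<mu> \<nu> c lam t * matE N c lam t"
proof -
  note I = mat_inv_invertible[OF matE_carrier assms]
  note L = matL_carrier[of N k \<mu> \<nu> c lam t] and E = matE_carrier[of N c lam t]
  show "matL N k \<mu> \<nu> c lam t = matE N c lam t * matL' N k \<mu> \<nu> c lam t"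
    unfolding matL'_def using assoc_mult_mat[OF E I(1) L] I(2) L by simp
  show "matL N k \<mu> \<nu> c lam t = matL'' N k \<mu> \<nu> c lam t * matE N c lam t"
    unfolding matL''_def using assoc_mult_mat[OF L I(1) E] I(3) L by simp
qed

end

theory Submission
  imports Defs
begin

text \<open>
  Let \<open>K = p H + q J\<close>. Since \<open>E\<close> is invertible and \<open>L = E L' = L'' E\<close>, the inverses cancel in
  \<open>E X - Y E\<close>, and the two halves of \<open>K\<close> add up:
  \<open>E X - Y E = p (L F - F L + H) + q (L G - G L + J)\<close>.
  As \<open>F\<close> and \<open>G\<close> are bidiagonal, an entry of either commutator involves \<open>L\<close> only at the position
  itself and at one neighbour in its row and in its column.

  Put \<open>d\<^sub>n = c\<^sub>n\<close> and \<open>a\<^sub>n = \<lambda>\<^sub>n\<close>, except \<open>d\<^sub>k\<^sub>+\<^sub>1 = c\<^sub>k\<^sub>+\<^sub>1 - \<mu>\<close> and \<open>a\<^sub>k\<^sub>+\<^sub>1 = \<nu> \<lambda>\<^sub>k\<^sub>+\<^sub>1\<close>. In these variables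
  the Toda equations take one form for all \<open>n\<close>:
  \<open>d\<^sub>n' = p d\<^sub>n (a\<^sub>n - a\<^sub>n\<^sub>+\<^sub>1) + q (a\<^sub>n\<^sub>+\<^sub>1 / d\<^sub>n\<^sub>+\<^sub>1 - a\<^sub>n / d\<^sub>n\<^sub>-\<^sub>1)\<close> and
  \<open>\<lambda>\<^sub>n' = p \<lambda>\<^sub>n (a\<^sub>n\<^sub>-\<^sub>1 + d\<^sub>n\<^sub>-\<^sub>1 - \<lambda>\<^sub>n\<^sub>+\<^sub>1 - d\<^sub>n - \<epsilon>\<^sub>n) + q \<lambda>\<^sub>n (1 / d\<^sub>n\<^sub>-\<^sub>1 - 1 / d\<^sub>n)\<close>,
  where \<open>\<epsilon>\<^sub>k\<^sub>+\<^sub>1 = \<nu>' / (p \<nu>) + (\<nu> - 1) \<lambda>\<^sub>k\<^sub>+\<^sub>1\<close> and \<open>\<epsilon>\<^sub>n = 0\<close> otherwise.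
  The coefficients of \<open>p\<close> and of \<open>q\<close> in each entry can then be
  compared separately: the first comparison (\<open>p_identity\<close>) is polynomial, and the second one
  (\<open>q_identity\<close>) uses no more than \<open>d\<^sub>n (1 / d\<^sub>n) = 1\<close>. The boundary conditions \<open>\<lambda>\<^sub>1 = \<lambda>\<^sub>N\<^sub>+\<^sub>1 = 0\<close>
  remove the terms that refer to rows and columns outside \<open>1..N\<close>.
\<close>

section \<open>Entrywise identities at a fixed time\<close>

text \<open>The values of the functions at one time. The derivatives of \<open>\<mu>\<close> and \<open>\<nu>\<close> enter below through
  \<open>x = \<nu>' / (p \<nu>)\<close> and \<open>y = \<mu>' / p\<close>, which makes the coefficients of \<open>p\<close> polynomials.\<close>

locale perturbed_values =
  fixes k :: nat and \<mu> \<nu> :: complex and c lam :: "nat \<Rightarrow> complex"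
  assumes k_gt_1: "1 < k" and lam_1: "lam 1 = 0"
begin

text \<open>The perturbed diagonal and subdiagonal values.\<close>

definition d :: "nat \<Rightarrow> complex" where
  "d n = (if n = k+1 then c n - \<mu> else c n)"

definition a :: "nat \<Rightarrow> complex" where
  "a n = (if n = k+1 then \<nu> * lam n else lam n)"

text \<open>The entries of the matrices \<open>L\<close>, \<open>H\<close> and \<open>J\<close>, for row and column numbers from \<open>1\<close> on and
  without an upper bound. In \<open>J\<close> the quotients \<open>c\<^sub>k\<^sub>+\<^sub>1 / d\<^sub>k\<^sub>+\<^sub>1\<close> are written as \<open>1 + \<mu> / d\<^sub>k\<^sub>+\<^sub>1\<close>,
  and \<open>c\<^sub>k / d\<^sub>k\<close> as \<open>1\<close>.\<close>

definition L :: "nat \<Rightarrow> nat \<Rightarrow> complex" where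
  "L i j =
    (if i = k+1 \<and> j = k then \<nu> * lam (k+1)
     else if i = k+1 \<and> j = k+1 then lam (k+2) + c (k+1) - \<mu>
     else if i \<le> j then lam (j+1) + c j
     else if i = j + 1 then lam i
     else 0)"

definition H :: "complex \<Rightarrow> complex \<Rightarrow> nat \<Rightarrow> nat \<Rightarrow> complex" where
  "H x y i j =
    (let \<gamma> = (\<lambda>n. lam (n+1) + c n) in
     if i \<le> k \<and> j = k then (- x + (1 - \<nu>) * \<gamma> k + \<mu>) * lam (k+1)
     else if i \<le> k+1 \<and> j = k+1 then lam (k+1) * (\<nu> * (\<gamma> (k+1) - \<mu>) - \<gamma> (k+1)) + y
     else if i = k+1 \<and> j = k-1 then - ((1 - \<nu>) * lam k * lam (k+1))
     else if i = k+1 \<and> j = k then - (x * lam (k+1)) + (1 - \<nu>) * lam k * lam (k+1)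
     else if i = k+2 \<and> j = k then (1 - \<nu>) * lam (k+1) * lam (k+2)
     else if i = k+2 \<and> j = k+1 then - ((1 - \<nu>) * lam (k+1) * lam (k+2))
     else 0)"

definition J :: "nat \<Rightarrow> nat \<Rightarrow> complex" where
  "J i j =
    (let g = 1 / d k; h = 1 / d (k+1) in
     if i < k \<and> j = k then (\<nu> - 1) * lam (k+1) * h
     else if i < k \<and> j = k+1 then (1 - \<nu>) * lam (k+1) * g - \<mu> * h
     else if i \<le> k \<and> j = k+2 then \<mu> * h
     else if (i = k \<or> i = k+1) \<and> j = k then (1 - \<nu>) * lam (k+1) * (g - h)
     else if i = k \<and> j = k+1 then (1 - \<nu>) * lam (k+1) * g - \<mu> * h + \<mu> * g
     else 0)"

text \<open>The coefficients of \<open>p\<close> and of \<open>q\<close> in the derivatives of \<open>\<lambda>\<^sub>n\<close> and \<open>c\<^sub>n\<close>.\<close>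

definition lam_p :: "complex \<Rightarrow> nat \<Rightarrow> complex" where
  "lam_p x n = lam n * (a (n-1) + d (n-1) - lam (n+1) - d n
                        - (if n = k+1 then x + a n - lam n else 0))"

definition lam_q :: "nat \<Rightarrow> complex" where
  "lam_q n = lam n * (1 / d (n-1) - 1 / d n)"

definition c_p :: "complex \<Rightarrow> nat \<Rightarrow> complex" where
  "c_p y n = d n * (a n - a (n+1)) + (if n = k+1 then y else 0)"

definition c_q :: "nat \<Rightarrow> complex" where
  "c_q n = a (n+1) / d (n+1) - a n / d (n-1)"

lemma p_identity:
  assumes "1 \<le> i" "1 \<le> j"
  shows "(lam j - lam i) * L i j - lam (j+1) * L i (j+1) + lam i * L (i-1) j + H x y i j
    = (if i \<le> j then lam_p x (j+1) + c_p y j else if i = j+1 then lam_p x i else 0)"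
proof -
  define i' j' k' where "i' = i - 1" "j' = j - 1" "k' = k - 2"
  then have ij: "i = Suc i'" "j = Suc j'" and k: "k = Suc (Suc k')"
    using assms k_gt_1 by auto
  have lam1: "lam (Suc 0) = 0" using lam_1 by simp
  consider "i < j" | "i = j" | "i = Suc j" | "i = Suc (Suc j)" | "i > Suc (Suc j)" by linarith
  then show ?thesis
  proof cases
    case 1
    then show ?thesis using lam1
      unfolding lam_p_def c_p_def L_def H_def Let_def a_def d_def unfolding ij k
      by (cases i') (auto simp: algebra_simps)
  next
    case 2
    then show ?thesis using lam1
      unfolding lam_p_def c_p_def L_def H_def Let_def a_def d_def unfolding ij k
      by (cases i') (auto simp: algebra_simps)
  next
    case 3
    then show ?thesis using lam1
      unfolding lam_p_def c_p_def L_def H_def Let_def a_def d_def unfolding ij k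
      by (auto simp: algebra_simps)
  next
    case 4
    then show ?thesis using lam1
      unfolding lam_p_def c_p_def L_def H_def Let_def a_def d_def unfolding ij k
      by (auto simp: algebra_simps)
  next
    case 5
    then show ?thesis using lam1
      unfolding lam_p_def c_p_def L_def H_def Let_def a_def d_def unfolding ij k
      by (auto simp: algebra_simps)
  qed
qed

lemma q_identity:
  assumes "1 \<le> i" "1 \<le> j" and nz: "\<And>n. 1 \<le> n \<Longrightarrow> n \<le> j \<Longrightarrow> d n \<noteq> 0"
  shows "(1 / d j - 1 / d i) * L i j - 1 / d (j-1) * L i (j-1) + 1 / d i * L (i+1) j + J i j
    = (if i \<le> j then lam_q (j+1) + c_q j else if i = j+1 then lam_q i else 0)"
proof -
  define i' j' k' where "i' = i - 1" "j' = j - 1" "k' = k - 2"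
  then have ij: "i = Suc i'" "j = Suc j'" and k: "k = Suc (Suc k')"
    using assms(1,2) k_gt_1 by auto
  have lam1: "lam (Suc 0) = 0" using lam_1 by simp
  \<comment> \<open>With the reciprocals as independent quantities \<open>g n\<close>, only the products \<open>c n * g n\<close> for
    \<open>n = j\<close> and \<open>n = j - 1\<close> have to be evaluated; the rest of the identity is polynomial.\<close>
  define g where "g n = 1 / d n" for n
  have div: "z / d n = z * g n" for z n by (simp add: g_def)
  have cg: "c n * g n = (if n = k+1 then 1 + \<mu> * g n else 1)" if "1 \<le> n" "n \<le> j" for n
    using nz[OF that] by (auto simp: g_def d_def field_simps)
  have gc: "c j * g j = (if j = k+1 then 1 + \<mu> * g j else 1)"
    "j' > 0 \<Longrightarrow> c j' * g j' = (if j' = k+1 then 1 + \<mu> * g j' else 1)"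
    using cg[of j] cg[of j'] assms(1,2) ij by auto
  consider "i < j" | "i = j" | "i = Suc j" | "i > Suc j" by linarith
  then show ?thesis
  proof cases
    case 1
    then have j': "j' > 0" using ij by simp
    from 1 show ?thesis using lam1 gc(1) gc(2)[OF j']
      unfolding lam_q_def c_q_def L_def J_def Let_def a_def div unfolding ij k
      by (auto simp: algebra_simps less_Suc_eq)
  next
    case 2
    then show ?thesis using lam1 gc
      unfolding lam_q_def c_q_def L_def J_def Let_def a_def div unfolding ij k
      by (auto simp: algebra_simps)
  next
    case 3
    then show ?thesis using lam1
      unfolding lam_q_def c_q_def L_def J_def Let_def a_def div unfolding ij k
      by (auto simp: algebra_simps)
  next
    case 4
    then show ?thesis using lam1
      unfolding lam_q_def c_q_def L_def J_def Let_def a_def div unfolding ij k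
      by (auto simp: algebra_simps)
  qed
qed

end

section \<open>Commutators with bidiagonal matrices\<close>

lemma mat1_carrier [simp]: "mat1 N f \<in> carrier_mat N N"
  by (simp add: mat1_def)

lemma mat1_index [simp]: "i < N \<Longrightarrow> j < N \<Longrightarrow> mat1 N f $$ (i, j) = f (i+1) (j+1)"
  by (simp add: mat1_def)

lemma mat1_mult_index:
  assumes "i < N" "j < N"
  shows "(mat1 N f * mat1 N g) $$ (i, j) = (\<Sum>r=1..N. f (i+1) r * g r (j+1))"
proof -
  have "(mat1 N f * mat1 N g) $$ (i, j) = (\<Sum>r=0..<N. f (i+1) (r+1) * g (r+1) (j+1))"
    using assms by (simp add: mat1_def scalar_prod_def)
  also have "\<dots> = (\<Sum>r=1..N. f (i+1) r * g r (j+1))"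
    by (rule sum.reindex_bij_witness[where i = "\<lambda>r. r - 1" and j = "\<lambda>r. r + 1"]) auto
  finally show ?thesis .
qed

lemma sum_two_terms:
  fixes f :: "'a \<Rightarrow> 'b::comm_monoid_add"
  assumes "finite A" "u \<noteq> v" and "\<And>r. r \<in> A \<Longrightarrow> r \<noteq> u \<Longrightarrow> r \<noteq> v \<Longrightarrow> f r = 0"
  shows "sum f A = (if u \<in> A then f u else 0) + (if v \<in> A then f v else 0)"
proof -
  have "sum f A = sum f (A \<inter> {u, v})"
    using assms by (intro sum.mono_neutral_right) auto
  also have "\<dots> = (if u \<in> A then f u else 0) + (if v \<in> A then f v else 0)"
    using assms(2) by (auto simp: Int_insert_right)
  finally show ?thesis .
qed

lemma lower_bidiagonal_commutator:
  fixes L :: "nat \<Rightarrow> nat \<Rightarrow> complex"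
  assumes "i \<in> {1..N}" "j \<in> {1..N}" and "l 1 = 0" "l (N+1) = 0"
    and F: "\<And>i j. F i j = (if i = j then l i else if i = j + 1 then - l i else 0)"
  shows "(\<Sum>r=1..N. L i r * F r j) - (\<Sum>r=1..N. F i r * L r j)
    = (l j - l i) * L i j - l (j+1) * L i (j+1) + l i * L (i-1) j"
proof -
  have "(\<Sum>r=1..N. L i r * F r j) = l j * L i j - l (j+1) * L i (j+1)"
  proof (subst sum_two_terms[of _ j "j+1"])
    have "l (Suc j) = 0" if "\<not> Suc j \<le> N"
      using that assms(2,4) by (simp add: not_less_eq_eq le_antisym)
    then show "(if j \<in> {1..N} then L i j * F j j else 0)
        + (if j+1 \<in> {1..N} then L i (j+1) * F (j+1) j else 0)
      = l j * L i j - l (j+1) * L i (j+1)"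
      using assms by auto
  qed (auto simp: F)
  moreover have "(\<Sum>r=1..N. F i r * L r j) = l i * L i j - l i * L (i-1) j"
  proof (subst sum_two_terms[of _ i "i-1"])
    have "i = 1" if "i - 1 \<notin> {1..N}" using that assms(1) by auto
    then show "(if i \<in> {1..N} then F i i * L i j else 0)
        + (if i-1 \<in> {1..N} then F i (i-1) * L (i-1) j else 0)
      = l i * L i j - l i * L (i-1) j"
      using assms by auto
  qed (use assms(1) in \<open>auto simp: F\<close>)
  ultimately show ?thesis by (simp add: algebra_simps)
qed

lemma upper_bidiagonal_commutator:
  fixes L :: "nat \<Rightarrow> nat \<Rightarrow> complex"
  assumes "i \<in> {1..N}" "j \<in> {1..N}" and "L i 0 = 0" "L (N+1) j = 0"
    and G: "\<And>i j. G i j = (if i = j then g i else if j = i + 1 then - g i else 0)"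
  shows "(\<Sum>r=1..N. L i r * G r j) - (\<Sum>r=1..N. G i r * L r j)
    = (g j - g i) * L i j - g (j-1) * L i (j-1) + g i * L (i+1) j"
proof -
  have "(\<Sum>r=1..N. L i r * G r j) = g j * L i j - g (j-1) * L i (j-1)"
  proof (subst sum_two_terms[of _ j "j-1"])
    have "j = 1" if "j - 1 \<notin> {1..N}" using that assms(2) by auto
    then show "(if j \<in> {1..N} then L i j * G j j else 0)
        + (if j-1 \<in> {1..N} then L i (j-1) * G (j-1) j else 0)
      = g j * L i j - g (j-1) * L i (j-1)"
      using assms by auto
  qed (use assms(2) in \<open>auto simp: G\<close>)
  moreover have "(\<Sum>r=1..N. G i r * L r j) = g i * L i j - g i * L (i+1) j"
  proof (subst sum_two_terms[of _ i "i+1"])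
    have "L (Suc i) j = 0" if "\<not> Suc i \<le> N"
      using that assms(1,4) by (simp add: not_less_eq_eq le_antisym)
    then show "(if i \<in> {1..N} then G i i * L i j else 0)
        + (if i+1 \<in> {1..N} then G i (i+1) * L (i+1) j else 0)
      = g i * L i j - g i * L (i+1) j"
      using assms by auto
  qed (auto simp: G)
  ultimately show ?thesis by (simp add: algebra_simps)
qed

section \<open>The right-hand side as a sum of commutators\<close>

lemma cancel_inverse_in_commutator:
  fixes E B L F G K :: "complex mat"
  assumes carr: "E \<in> carrier_mat n n" "B \<in> carrier_mat n n" "L \<in> carrier_mat n n"
      "F \<in> carrier_mat n n" "G \<in> carrier_mat n n" "K \<in> carrier_mat n n"
    and inv: "E * B = 1\<^sub>m n" "B * E = 1\<^sub>m n"
  shows "E * (p \<cdot>\<^sub>m (B * L * F) + q \<cdot>\<^sub>m (B * L * G) + (1/2) \<cdot>\<^sub>m (B * K))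
      - (p \<cdot>\<^sub>m (F * (L * B)) + q \<cdot>\<^sub>m (G * (L * B)) - (1/2) \<cdot>\<^sub>m (K * B)) * E
    = p \<cdot>\<^sub>m (L * F - F * L) + q \<cdot>\<^sub>m (L * G - G * L) + K"
proof -
  have left: "E * (B * M) = M" if "M \<in> carrier_mat n n" for M
    using that carr inv by (simp flip: assoc_mult_mat[of E n n B n M n])
  have "E * (p \<cdot>\<^sub>m (B * L * F) + q \<cdot>\<^sub>m (B * L * G) + (1/2) \<cdot>\<^sub>m (B * K))
      = p \<cdot>\<^sub>m (E * (B * (L * F))) + q \<cdot>\<^sub>m (E * (B * (L * G))) + (1/2) \<cdot>\<^sub>m (E * (B * K))"
    using carr by (simp add: mult_add_distrib_mat[of _ n n _ n] mult_smult_distrib[of _ n n _ n])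
  then have EX: "E * (p \<cdot>\<^sub>m (B * L * F) + q \<cdot>\<^sub>m (B * L * G) + (1/2) \<cdot>\<^sub>m (B * K))
      = p \<cdot>\<^sub>m (L * F) + q \<cdot>\<^sub>m (L * G) + (1/2) \<cdot>\<^sub>m K"
    using carr by (simp add: left)
  have right: "M * (L * B) * E = M * L" if "M \<in> carrier_mat n n" for M
  proof -
    have "M * (L * B) * E = M * (L * B * E)"
      by (rule assoc_mult_mat[where ?n\<^sub>2.0 = n and ?n\<^sub>3.0 = n and ?n\<^sub>4.0 = n])
        (use that carr in auto)
    then show ?thesis using carr inv(2) by simp
  qed
  have YE: "(p \<cdot>\<^sub>m (F * (L * B)) + q \<cdot>\<^sub>m (G * (L * B)) - (1/2) \<cdot>\<^sub>m (K * B)) * E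
      = p \<cdot>\<^sub>m (F * L) + q \<cdot>\<^sub>m (G * L) - (1/2) \<cdot>\<^sub>m K"
    using carr inv(2)
    by (simp add: add_mult_distrib_mat[of _ n n _ _ n] minus_mult_distrib_mat[of _ n n _ _ n]
        mult_smult_assoc_mat[of _ n n _ n] right)
  have "p \<cdot>\<^sub>m (L * F) + q \<cdot>\<^sub>m (L * G) + (1/2) \<cdot>\<^sub>m K
      - (p \<cdot>\<^sub>m (F * L) + q \<cdot>\<^sub>m (G * L) - (1/2) \<cdot>\<^sub>m K)
    = p \<cdot>\<^sub>m (L * F - F * L) + q \<cdot>\<^sub>m (L * G - G * L) + K"
    using carr by (intro eq_matI) (simp_all add: algebra_simps)
  then show ?thesis unfolding EX YE .
qed

lemma matL_eq_mat1:
  "matL N k \<mu> \<nu> c lam t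
    = mat1 N (perturbed_values.L k (\<mu> t) (\<nu> t) (\<lambda>n. c n t) (\<lambda>n. lam n t))"
  if "1 < k" "lam 1 t = 0"
proof -
  interpret perturbed_values k "\<mu> t" "\<nu> t" "\<lambda>n. c n t" "\<lambda>n. lam n t"
    using that by unfold_locales
  show ?thesis
    unfolding matL_def L_def[abs_def] gam_def by (simp cong: if_cong)
qed

lemma matH_eq_mat1:
  "matH N k p \<mu> \<nu> c lam t
    = mat1 N (perturbed_values.H k (\<mu> t) (\<nu> t) (\<lambda>n. c n t) (\<lambda>n. lam n t)
        (ddt \<nu> t / (p * \<nu> t)) (inverse p * ddt \<mu> t))"
  if "1 < k" "lam 1 t = 0"
proof -
  interpret perturbed_values k "\<mu> t" "\<nu> t" "\<lambda>n. c n t" "\<lambda>n. lam n t"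
    using that by unfold_locales
  show ?thesis
    unfolding matH_def H_def[abs_def] Let_def gam_def by (simp cong: if_cong)
qed

lemma matJ_eq_mat1:
  "matJ N k \<mu> \<nu> c lam t
    = mat1 N (perturbed_values.J k (\<mu> t) (\<nu> t) (\<lambda>n. c n t) (\<lambda>n. lam n t))"
  if "1 < k" "lam 1 t = 0" "c k t \<noteq> 0" "c (k+1) t \<noteq> \<mu> t"
proof -
  interpret perturbed_values k "\<mu> t" "\<nu> t" "\<lambda>n. c n t" "\<lambda>n. lam n t"
    using that by unfold_locales
  have i_less: "i \<le> k - 1 \<longleftrightarrow> i < k" for i using that(1) by auto
  have nz: "c (k+1) t - \<mu> t \<noteq> 0" using that(4) by simp
  define h where "h = 1 / (c (k+1) t - \<mu> t)"
  define g where "g = 1 / c k t"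
  have gh: "z / (c (k+1) t - \<mu> t) = z * h" "z / c k t = z * g" for z
    by (simp_all add: h_def g_def)
  have h: "c (k+1) t * h = 1 + \<mu> t * h" using nz by (simp add: h_def field_simps)
  have g: "c k t * g = 1" using that(3) by (simp add: g_def)
  have d: "d k = c k t" "d (k+1) = c (k+1) t - \<mu> t" by (simp_all add: d_def)
  have den: "gam c lam (k+1) t - lam (k+2) t - \<mu> t = c (k+1) t - \<mu> t"
    "gam c lam k t - lam (k+1) t = c k t"
    "lam (k+2) t - gam c lam (k+1) t = - c (k+1) t"
    by (simp_all add: gam_def)
  show ?thesis
    unfolding matJ_def J_def[abs_def] Let_def den i_less d gh
    by (rule arg_cong[of _ _ "mat1 N"], intro ext)
      (use h g in \<open>auto simp: gam_def algebra_simps\<close>)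
qed

section \<open>The derivatives of the entries\<close>

text \<open>The factors \<open>w\<close> and \<open>w'\<close> need not be nonzero: \<open>w = c\<^sub>N\<^sub>+\<^sub>1\<close> occurs below, with \<open>u = 0\<close>.\<close>

lemma clear_logarithmic_derivative:
  fixes D z :: complex
  assumes "D / z = p * A + q * (u / (w * z) - s / (z * w'))" and "z \<noteq> 0"
  shows "D = p * (z * A) + q * (u / w - s / w')"
proof -
  have "D = z * (p * A + q * (u / (w * z) - s / (z * w')))"
    using assms by (simp flip: assms(1))
  also have "\<dots> = p * (z * A) + q * (z * (u / (w * z)) - z * (s / (z * w')))"
    by (simp add: algebra_simps)
  also have "\<dots> = p * (z * A) + q * (u / w - s / w')"
    using assms(2) by simp
  finally show ?thesis .
qed

context
  fixes N k :: nat and p q :: complex and \<mu> \<nu> :: "real \<Rightarrow> complex"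
    and c lam :: sequence and T :: "real set" and t :: real
  assumes k: "1 < k" "k < N" and p: "p \<noteq> 0" and T: "open T" "t \<in> T"
    and lam_bd: "\<forall>t\<in>T. lam 0 t = - 1 \<and> lam 1 t = 0 \<and> lam (N+1) t = 0"
    and dn: "denominators_nonzero N k \<mu> \<nu> c lam T"
    and toda: "perturbed_toda N k p q \<mu> \<nu> c lam T"
begin

text \<open>The values at the fixed time \<open>t \<in> T\<close> form an instance of the algebraic setting above.\<close>

lemma lam_1_t: "lam 1 t = 0" and lam_Suc_N_t: "lam (N+1) t = 0"
  using lam_bd T by auto

interpretation perturbed_values k "\<mu> t" "\<nu> t" "\<lambda>n. c n t" "\<lambda>n. lam n t"
  using k(1) lam_1_t by unfold_locales

lemma d_nonzero: "d n \<noteq> 0" if "1 \<le> n" "n \<le> N"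
  using dn T that unfolding denominators_nonzero_def d_def by auto

lemma lam_nonzero: "lam n t \<noteq> 0" if "2 \<le> n" "n \<le> N"
  using dn T that unfolding denominators_nonzero_def by auto

lemma toda_c_t: "toda_c N k p q \<mu> \<nu> c lam t"
  and toda_lambda_t: "toda_lambda N k p q \<mu> \<nu> c lam t"
  using toda T unfolding perturbed_toda_def by auto

lemma lam_derivative:
  assumes "2 \<le> n" "n \<le> N+1"
  shows "(lam n has_vector_derivative p * lam_p (ddt \<nu> t / (p * \<nu> t)) n + q * lam_q n) (at t)"
proof (cases "n = N+1")
  case True
  \<comment> \<open>\<open>\<lambda>\<^sub>N\<^sub>+\<^sub>1\<close> vanishes on the open set \<open>T\<close>, hence so does its derivative.\<close>
  have "(lam (N+1) has_vector_derivative 0) (at t)"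
    by (rule has_vector_derivative_transform_within_open[OF has_vector_derivative_const[of 0] T])
      (use lam_bd in auto)
  then show ?thesis
    unfolding True lam_p_def lam_q_def using lam_Suc_N_t by simp
next
  case False
  then have n: "n \<le> N" using assms by simp
  define x where "x = ddt \<nu> t / (p * \<nu> t)"
  have px: "ddt \<nu> t / \<nu> t = p * x" using p by (simp add: x_def)
  have "lam n differentiable (at t)"
    using toda T assms(1) n unfolding perturbed_toda_def by auto
  then have "(lam n has_vector_derivative ddt (lam n) t) (at t)"
    by (simp add: vector_derivative_works)
  moreover have "ddt (lam n) t = p * lam_p x n + q * lam_q n"
  proof -
    have D: "ddt (lam n) t = lam n t * r" if "ddt (lam n) t / lam n t = r" for r
      using lam_nonzero[OF assms(1) n] that by auto
    consider "n = k+1" | "n = k+2" | "n \<in> {2..N} - {k+1, k+2}"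
      using assms(1) n by auto
    then show ?thesis
    proof cases
      case 1
      have e: "ddt (lam n) t / lam n t = - (ddt \<nu> t / \<nu> t)
         - p * (lam (k+2) t + c (k+1) t - \<mu> t + (\<nu> t - 1) * lam (k+1) t - c k t - lam k t)
         - q * (1 / (c (k+1) t - \<mu> t) - 1 / c k t)"
        using toda_lambda_t 1 unfolding toda_lambda_def by simp
      show ?thesis
        unfolding D[OF e] px unfolding 1 lam_p_def lam_q_def a_def d_def
        by (simp add: algebra_simps)
    next
      case 2
      have e: "ddt (lam n) t / lam n t =
         - p * (lam (k+3) t + c (k+2) t - (c (k+1) t - \<mu> t) - \<nu> t * lam (k+1) t)
         - q * (1 / c (k+2) t - 1 / (c (k+1) t - \<mu> t))"
        using toda_lambda_t 2 n unfolding toda_lambda_def by simp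
      show ?thesis
        unfolding D[OF e] unfolding 2 lam_p_def lam_q_def a_def d_def
        by (simp add: algebra_simps numeral_3_eq_3)
    next
      case 3
      have e: "ddt (lam n) t / lam n t =
         p * (lam (n-1) t + c (n-1) t - lam (n+1) t - c n t) + q * (1 / c (n-1) t - 1 / c n t)"
        using toda_lambda_t 3 unfolding toda_lambda_def by blast
      have "n \<noteq> k+1" "n-1 \<noteq> k+1" using 3 by auto
      then show ?thesis
        unfolding D[OF e] unfolding lam_p_def lam_q_def a_def d_def
        by (simp add: algebra_simps)
    qed
  qed
  ultimately show ?thesis by (simp add: x_def)
qed

lemma c_derivative:
  assumes "1 \<le> n" "n \<le> N"
  shows "(c n has_vector_derivative p * c_p (inverse p * ddt \<mu> t) n + q * c_q n) (at t)"
proof -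
  have nz: "c n t \<noteq> 0" if "n \<noteq> k+1"
    using d_nonzero[OF assms] that by (simp add: d_def)
  have "c n differentiable (at t)"
    using toda T assms unfolding perturbed_toda_def by auto
  then have "(c n has_vector_derivative ddt (c n) t) (at t)"
    by (simp add: vector_derivative_works)
  moreover have "ddt (c n) t = p * c_p (inverse p * ddt \<mu> t) n + q * c_q n"
  proof -
    consider "n = k" | "n = k+1" | "n = k+2" | "n \<in> {1..N} - {k, k+1, k+2}"
      using assms by auto
    then show ?thesis
    proof cases
      case 1
      have "ddt (c n) t / c n t = p * (lam k t - \<nu> t * lam (k+1) t)
         + q * (\<nu> t * lam (k+1) t / ((c (k+1) t - \<mu> t) * c n t) - lam k t / (c n t * c (k-1) t))"
        using toda_c_t 1 unfolding toda_c_def by blast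
      from clear_logarithmic_derivative[OF this] nz 1 show ?thesis
        unfolding c_p_def c_q_def a_def d_def by simp
    next
      case 2
      have "ddt (c n) t =
         ddt \<mu> t + p * (c (k+1) t - \<mu> t) * (\<nu> t * lam (k+1) t - lam (k+2) t)
         + q * (lam (k+2) t / c (k+2) t - \<nu> t * lam (k+1) t / c k t)"
        using toda_c_t 2 unfolding toda_c_def by blast
      with 2 p show ?thesis
        unfolding c_p_def c_q_def a_def d_def by (simp add: algebra_simps)
    next
      case 3
      have "ddt (c n) t / c n t = p * (lam (k+2) t - lam (k+3) t)
         + q * (lam (k+3) t / (c (k+3) t * c n t) - lam (k+2) t / (c n t * (c (k+1) t - \<mu> t)))"
        using toda_c_t 3 assms unfolding toda_c_def by (simp add: mult.commute)
      from clear_logarithmic_derivative[OF this] nz 3 show ?thesis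
        unfolding c_p_def c_q_def a_def d_def by (simp add: numeral_3_eq_3)
    next
      case 4
      have "ddt (c n) t / c n t = p * (lam n t - lam (n+1) t)
         + q * (lam (n+1) t / (c (n+1) t * c n t) - lam n t / (c n t * c (n-1) t))"
        using toda_c_t 4 unfolding toda_c_def by blast
      moreover have "n \<noteq> k+1" "n-1 \<noteq> k+1" "n+1 \<noteq> k+1" using 4 by auto
      ultimately show ?thesis
        using clear_logarithmic_derivative nz
        unfolding c_p_def c_q_def a_def d_def by simp
    qed
  qed
  ultimately show ?thesis by simp
qed

lemma commutator_entry:
  assumes ij: "i < N" "j < N"
  shows "(p \<cdot>\<^sub>m (matL N k \<mu> \<nu> c lam t * matF N lam t - matF N lam t * matL N k \<mu> \<nu> c lam t)
      + q \<cdot>\<^sub>m (matL N k \<mu> \<nu> c lam t * matG N k \<mu> c lam t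
               - matG N k \<mu> c lam t * matL N k \<mu> \<nu> c lam t)
      + (p \<cdot>\<^sub>m matH N k p \<mu> \<nu> c lam t + q \<cdot>\<^sub>m matJ N k \<mu> \<nu> c lam t)) $$ (i, j)
    = (let x = ddt \<nu> t / (p * \<nu> t); y = inverse p * ddt \<mu> t in
       if i \<le> j then p * (lam_p x (j+2) + c_p y (j+1)) + q * (lam_q (j+2) + c_q (j+1))
       else if i = j+1 then p * lam_p x (i+1) + q * lam_q (i+1)
       else 0)"
proof -
  let ?x = "ddt \<nu> t / (p * \<nu> t)" and ?y = "inverse p * ddt \<mu> t"
  define F where "F i j = (if i = j then lam i t else if i = j + 1 then - lam i t else 0)"
    for i j
  define G where "G i j = (if i = j then 1 / d i else if j = i + 1 then - (1 / d i) else 0)"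
    for i j
  have mF: "matF N lam t = mat1 N F"
    unfolding matF_def F_def[abs_def] ..
  have gd: "(if i = k+1 then 1 / (gam c lam (k+1) t - lam (k+2) t - \<mu> t)
      else 1 / (gam c lam i t - lam (i+1) t)) = 1 / d i" for i
    by (simp add: gam_def d_def)
  have mG: "matG N k \<mu> c lam t = mat1 N G"
    unfolding matG_def Let_def gd G_def[abs_def] ..
  have mL: "matL N k \<mu> \<nu> c lam t = mat1 N L"
    using matL_eq_mat1 k(1) lam_1_t by simp
  have mH: "matH N k p \<mu> \<nu> c lam t = mat1 N (H ?x ?y)"
    using matH_eq_mat1 k(1) lam_1_t by simp
  have mJ: "matJ N k \<mu> \<nu> c lam t = mat1 N J"
    using matJ_eq_mat1 k lam_1_t d_nonzero[of k] d_nonzero[of "k+1"] by (simp add: d_def)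
  have ij1: "i+1 \<in> {1..N}" "j+1 \<in> {1..N}" using ij by auto
  have L0: "L (i+1) 0 = 0" "L (N+1) (j+1) = 0"
    using k ij lam_1_t lam_Suc_N_t by (auto simp: L_def)
  note LF = lower_bidiagonal_commutator[where l = "\<lambda>n. lam n t", OF ij1 lam_1_t lam_Suc_N_t F_def,
      of L]
  note LG = upper_bidiagonal_commutator[where g = "\<lambda>n. 1 / d n" and L = L, OF ij1 L0 G_def]
  have "(p \<cdot>\<^sub>m (mat1 N L * mat1 N F - mat1 N F * mat1 N L)
      + q \<cdot>\<^sub>m (mat1 N L * mat1 N G - mat1 N G * mat1 N L)
      + (p \<cdot>\<^sub>m mat1 N (H ?x ?y) + q \<cdot>\<^sub>m mat1 N J)) $$ (i, j)
    = p * ((mat1 N L * mat1 N F) $$ (i, j) - (mat1 N F * mat1 N L) $$ (i, j) + H ?x ?y (i+1) (j+1))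
      + q * ((mat1 N L * mat1 N G) $$ (i, j) - (mat1 N G * mat1 N L) $$ (i, j) + J (i+1) (j+1))"
    using ij by (simp add: mat1_def algebra_simps)
  also have "\<dots> = p * (if i+1 \<le> j+1 then lam_p ?x (j+1+1) + c_p ?y (j+1)
        else if i+1 = j+1+1 then lam_p ?x (i+1) else 0)
      + q * (if i+1 \<le> j+1 then lam_q (j+1+1) + c_q (j+1)
        else if i+1 = j+1+1 then lam_q (i+1) else 0)"
    unfolding mat1_mult_index[OF ij] LF LG
    using p_identity[of "i+1" "j+1" ?x ?y] q_identity[of "i+1" "j+1"] d_nonzero ij by simp
  finally show ?thesis
    unfolding mF mG mL mH mJ Let_def by simp
qed

lemma matE_derivative:
  assumes inv: "invertible_mat (matE N c lam t)"
  shows "has_mat_derivative (matE N c lam)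
    (matE N c lam t * matX N k p q \<mu> \<nu> c lam t - matY N k p q \<mu> \<nu> c lam t * matE N c lam t) t"
proof -
  note B = mat_inv_invertible[OF matE_carrier inv]
  define D where "D = p \<cdot>\<^sub>m (matL N k \<mu> \<nu> c lam t * matF N lam t - matF N lam t * matL N k \<mu> \<nu> c lam t)
      + q \<cdot>\<^sub>m (matL N k \<mu> \<nu> c lam t * matG N k \<mu> c lam t
               - matG N k \<mu> c lam t * matL N k \<mu> \<nu> c lam t)
      + (p \<cdot>\<^sub>m matH N k p \<mu> \<nu> c lam t + q \<cdot>\<^sub>m matJ N k \<mu> \<nu> c lam t)"
  have carr: "matF N lam t \<in> carrier_mat N N" "matG N k \<mu> c lam t \<in> carrier_mat N N"
    "p \<cdot>\<^sub>m matH N k p \<mu> \<nu> c lam t + q \<cdot>\<^sub>m matJ N k \<mu> \<nu> c lam t \<in> carrier_mat N N"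
    by (simp_all add: matF_def matG_def matH_def matJ_def Let_def)
  have D: "matE N c lam t * matX N k p q \<mu> \<nu> c lam t
      - matY N k p q \<mu> \<nu> c lam t * matE N c lam t = D"
    unfolding matX_def matY_def matL'_def matL''_def D_def
    by (rule cancel_inverse_in_commutator[OF matE_carrier B(1) matL_carrier carr B(2,3)])
  have dims: "dim_row D = N" "dim_col D = N"
    unfolding D_def using carr by auto
  have "((\<lambda>s. matE N c lam s $$ (i, j)) has_vector_derivative D $$ (i, j)) (at t)"
    if ij: "i < N" "j < N" for i j
  proof -
    consider "i \<le> j" | "i = j+1" | "i > j+1" by linarith
    then show ?thesis
    proof cases
      case 1
      have "((\<lambda>s. lam (j+2) s + c (j+1) s) has_vector_derivative D $$ (i, j)) (at t)"
        unfolding D_def commutator_entry[OF ij]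
        using has_vector_derivative_add[OF lam_derivative[of "j+2"] c_derivative[of "j+1"]] ij 1
        by (simp add: algebra_simps)
      then show ?thesis using 1 ij by (simp add: matE_def gam_def)
    next
      case 2
      then show ?thesis
        unfolding D_def commutator_entry[OF ij]
        using lam_derivative[of "i+1"] ij by (simp add: matE_def)
    next
      case 3
      then show ?thesis
        unfolding D_def commutator_entry[OF ij] using ij by (simp add: matE_def)
    qed
  qed
  then show ?thesis
    unfolding D has_mat_derivative_def using dims by (simp add: matE_def mat1_def)
qed

end

section \<open>The matrix differential equation\<close>

theorem theorem2p2:
  fixes N k :: nat
    and p q :: complex
    and \<mu> \<nu> :: "real \<Rightarrow> complex"
    and c lam :: "nat \<Rightarrow> real \<Rightarrow> complex"
    and T :: "real set"
  assumes "1 < k" and "k < N"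
    and "p \<noteq> 0"
    and "open T"
    and "\<forall>t\<in>T. c 0 t = 1"
    and "\<forall>t\<in>T. lam 0 t = - 1 \<and> lam 1 t = 0 \<and> lam (N+1) t = 0"
    and "denominators_nonzero N k \<mu> \<nu> c lam T"
    and "perturbed_toda N k p q \<mu> \<nu> c lam T"
    and "\<forall>t\<in>T. invertible_mat (matE N c lam t)"
  shows "\<forall>t\<in>T. has_mat_derivative (matE N c lam)
           (matE N c lam t * matX N k p q \<mu> \<nu> c lam t - matY N k p q \<mu> \<nu> c lam t * matE N c lam t) t"
  using matE_derivative[OF assms(1-4) _ assms(6-8)] assms(9) by blast

end
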